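(* Let $q$ be a timelike split quaternion with spacelike vector part, written in the form $q=N_q(\cosh\theta+\overrightarrow{\varepsilon}\sinh\theta)$, where $\theta\in\mathbb{R}$ and $\overrightarrow{\varepsilon}=(u_1,u_2,u_3)=u_1i+u_2j+u_3k$ is a spacelike unit vector in $\mathbb{E}_1^3$. Then for every positive integer $n$, $$(\mathbf{L}_q)^n=(N_q)^n\begin{bmatrix}\cosh n\theta&-u_1\sinh n\theta&u_2\sinh n\theta&u_3\sinh n\theta\\ u_1\sinh n\theta&\cosh n\theta&u_3\sinh n\theta&-u_2\sinh n\theta\\ u_2\sinh n\theta&u_3\sinh n\theta&\cosh n\theta&-u_1\sinh n\theta\\ u_3\sinh n\theta&-u_2\sinh n\theta&u_1\sinh n\theta&\cosh n\theta\end{bmatrix}=(N_q)^n[\cosh n\theta\,\mathbf{I}_4+\sinh n\theta\,\mathbf{L}_{\overrightarrow{\varepsilon}}],$$ $$(\mathbf{R}_q)^n=(N_q)^n\begin{bmatrix}\cosh n\theta&-u_1\sinh n\theta&u_2\sinh n\theta&u_3\sinh n\theta\\ u_1\sinh n\theta&\cosh n\theta&-u_3\sinh n\theta&u_2\sinh n\theta\\ u_2\sinh n\theta&-u_3\sinh n\theta&\cosh n\theta&u_1\sinh n\theta\\ u_3\sinh n\theta&u_2\sinh n\theta&-u_1\sinh n\theta&\cosh n\theta\end{bmatrix}=(N_q)^n[\cosh n\theta\,\mathbf{I}_4+\sinh n\theta\,\mathbf{R}_{\overrightarrow{\varepsilon}}].$$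
   Context: The split quaternions $\widehat{\mathbb{H}}$ form the real associative algebra with basis $\{1,i,j,k\}$ and products $i^2=-1$, $j^2=k^2=1$, $ij=k=-ji$, $jk=-i=-kj$, $ki=j=-ik$. For $q=q_0+q_1i+q_2j+q_3k$, the vector part is $\overrightarrow{V_q}=q_1i+q_2j+q_3k$, and $I_q=q_0^2+q_1^2-q_2^2-q_3^2$, $N_q=\sqrt{|I_q|}$. The split quaternion $q$ is timelike if $I_q>0$, spacelike if $I_q<0$, lightlike if $I_q=0$. Pure split quaternions (those with $q_0=0$) $u_1i+u_2j+u_3k$ are identified with vectors $(u_1,u_2,u_3)$ of Minkowski 3-space $\mathbb{E}_1^3$, i.e. $\mathbb{R}^3$ with $\langle u,v\rangle_{\mathbb{L}}=-u_1v_1+u_2v_2+u_3v_3$. A vector $u$ is spacelike if $\langle u,u\rangle_{\mathbb{L}}>0$ and timelike if $\langle u,u\rangle_{\mathbb{L}}<0$; a spacelike unit vector satisfies $\langle u,u\rangle_{\mathbb{L}}=1$ and a timelike unit vector satisfies $\langle u,u\rangle_{\mathbb{L}}=-1$. The left and right matrix representations of $q$ (matrices of $p\mapsto qp$ and $p\mapsto pq$ in the basis $1,i,j,k$) are $$\mathbf{L}_q=\begin{bmatrix}q_0&-q_1&q_2&q_3\\ q_1&q_0&q_3&-q_2\\ q_2&q_3&q_0&-q_1\\ q_3&-q_2&q_1&q_0\end{bmatrix},\qquad \mathbf{R}_q=\begin{bmatrix}q_0&-q_1&q_2&q_3\\ q_1&q_0&-q_3&q_2\\ q_2&-q_3&q_0&q_1\\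 q_3&q_2&-q_1&q_0\end{bmatrix}.$$ $\mathbf{I}_4$ is the $4\times4$ identity matrix. *)

theory Defs
  imports Complex_Main "Jordan_Normal_Form.Matrix"
begin

section \<open>The algebra of split quaternions\<close>

codatatype split_quat = SQuat (q0: real) (q1: real) (q2: real) (q3: real)

lemma split_quat_eqI:
  "q0 p = q0 q \<Longrightarrow> q1 p = q1 q \<Longrightarrow> q2 p = q2 q \<Longrightarrow> q3 p = q3 q \<Longrightarrow> p = q"
  by (rule split_quat.expand) simp

lemma split_quat_eq_iff:
  "p = q \<longleftrightarrow> q0 p = q0 q \<and> q1 p = q1 q \<and> q2 p = q2 q \<and> q3 p = q3 q"
  by (auto intro: split_quat_eqI)

instantiation split_quat :: real_algebra_1
begin

primcorec zero_split_quat where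
  "q0 0 = 0" | "q1 0 = 0" | "q2 0 = 0" | "q3 0 = 0"

primcorec one_split_quat where
  "q0 1 = 1" | "q1 1 = 0" | "q2 1 = 0" | "q3 1 = 0"

primcorec plus_split_quat where
  "q0 (p + q) = q0 p + q0 q"
| "q1 (p + q) = q1 p + q1 q"
| "q2 (p + q) = q2 p + q2 q"
| "q3 (p + q) = q3 p + q3 q"

primcorec uminus_split_quat where
  "q0 (- q) = - q0 q"
| "q1 (- q) = - q1 q"
| "q2 (- q) = - q2 q"
| "q3 (- q) = - q3 q"

primcorec minus_split_quat where
  "q0 (p - q) = q0 p - q0 q"
| "q1 (p - q) = q1 p - q1 q"
| "q2 (p - q) = q2 p - q2 q"
| "q3 (p - q) = q3 p - q3 q"

primcorec scaleR_split_quat where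
  "q0 (scaleR r q) = r * q0 q"
| "q1 (scaleR r q) = r * q1 q"
| "q2 (scaleR r q) = r * q2 q"
| "q3 (scaleR r q) = r * q3 q"

text \<open>The bilinear extension of the products of basis elements in the lemma
  \<open>split_basis_products\<close> below.\<close>

primcorec times_split_quat where
  "q0 (p * q) = q0 p * q0 q - q1 p * q1 q + q2 p * q2 q + q3 p * q3 q"
| "q1 (p * q) = q0 p * q1 q + q1 p * q0 q - q2 p * q3 q + q3 p * q2 q"
| "q2 (p * q) = q0 p * q2 q + q2 p * q0 q + q3 p * q1 q - q1 p * q3 q"
| "q3 (p * q) = q0 p * q3 q + q3 p * q0 q + q1 p * q2 q - q2 p * q1 q"

instance
  by standard (simp_all add: split_quat_eq_iff algebra_simps)

end

definition split_i :: split_quat where "split_i = SQuat 0 1 0 0"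
definition split_j :: split_quat where "split_j = SQuat 0 0 1 0"
definition split_k :: split_quat where "split_k = SQuat 0 0 0 1"

lemma split_basis_products:
  "split_i * split_i = - 1" "split_j * split_j = 1" "split_k * split_k = 1"
  "split_i * split_j = split_k" "split_j * split_i = - split_k"
  "split_j * split_k = - split_i" "split_k * split_j = split_i"
  "split_k * split_i = split_j" "split_i * split_k = - split_j"
  by (simp_all add: split_quat_eq_iff split_i_def split_j_def split_k_def)

lemma split_quat_basis_expansion:
  "q = q0 q *\<^sub>R 1 + q1 q *\<^sub>R split_i + q2 q *\<^sub>R split_j + q3 q *\<^sub>R split_k"
  by (simp add: split_quat_eq_iff split_i_def split_j_def split_k_def)

definition sq_I :: "split_quat \<Rightarrow> real" where
  "sq_I q = (q0 q)\<^sup>2 + (q1 q)\<^sup>2 - (q2 q)\<^sup>2 - (q3 q)\<^sup>2"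

definition sq_N :: "split_quat \<Rightarrow> real" where
  "sq_N q = sqrt \<bar>sq_I q\<bar>"

definition timelike :: "split_quat \<Rightarrow> bool" where
  "timelike q \<longleftrightarrow> sq_I q > 0"

section \<open>Minkowski 3-space\<close>

type_synonym mink3 = "real \<times> real \<times> real"

definition lorentz :: "mink3 \<Rightarrow> mink3 \<Rightarrow> real" where
  "lorentz = (\<lambda>(u1, u2, u3) (v1, v2, v3). - (u1 * v1) + u2 * v2 + u3 * v3)"

definition spacelike_vec :: "mink3 \<Rightarrow> bool" where
  "spacelike_vec u \<longleftrightarrow> lorentz u u > 0"

definition spacelike_unit_vec :: "mink3 \<Rightarrow> bool" where
  "spacelike_unit_vec u \<longleftrightarrow> spacelike_vec u \<and> lorentz u u = 1"

text \<open>\<open>pure_quat\<close> is the identification of Minkowski vectors with pure split quaternions.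
  Through it, \<open>vec_part q\<close> is \<open>q1 i + q2 j + q3 k\<close>.\<close>

definition pure_quat :: "mink3 \<Rightarrow> split_quat" where
  "pure_quat = (\<lambda>(u1, u2, u3). u1 *\<^sub>R split_i + u2 *\<^sub>R split_j + u3 *\<^sub>R split_k)"

definition vec_part :: "split_quat \<Rightarrow> mink3" where
  "vec_part q = (q1 q, q2 q, q3 q)"

lemma split_quat_scalar_plus_vec_part:
  "q = of_real (q0 q) + pure_quat (vec_part q)"
  by (simp add: split_quat_eq_iff of_real_def pure_quat_def vec_part_def
      split_i_def split_j_def split_k_def)

section \<open>Left and right matrix representations\<close>

definition Lmat :: "split_quat \<Rightarrow> real mat" where
  "Lmat q = mat_of_rows_list 4
    [[q0 q, - q1 q,   q2 q,   q3 q],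
     [q1 q,   q0 q,   q3 q, - q2 q],
     [q2 q,   q3 q,   q0 q, - q1 q],
     [q3 q, - q2 q,   q1 q,   q0 q]]"

definition Rmat :: "split_quat \<Rightarrow> real mat" where
  "Rmat q = mat_of_rows_list 4
    [[q0 q, - q1 q,   q2 q,   q3 q],
     [q1 q,   q0 q, - q3 q,   q2 q],
     [q2 q, - q3 q,   q0 q,   q1 q],
     [q3 q,   q2 q, - q1 q,   q0 q]]"

definition sq_coords :: "split_quat \<Rightarrow> real vec" where
  "sq_coords q = vec_of_list [q0 q, q1 q, q2 q, q3 q]"

lemma Lmat_mult_coords: "Lmat q *\<^sub>v sq_coords p = sq_coords (q * p)"
  by (rule eq_vecI)
    (auto simp: Lmat_def sq_coords_def mat_of_rows_list_def scalar_prod_def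
      vec_of_list_index numeral_eq_Suc less_Suc_eq)

lemma Rmat_mult_coords: "Rmat q *\<^sub>v sq_coords p = sq_coords (p * q)"
  by (rule eq_vecI)
    (auto simp: Rmat_def sq_coords_def mat_of_rows_list_def scalar_prod_def
      vec_of_list_index numeral_eq_Suc less_Suc_eq)

end

theory Submission
  imports Defs
begin

text \<open>
  Since \<open>p \<mapsto> q * p\<close> and \<open>p \<mapsto> p * q\<close> are linear maps and multiplication is associative,
  \<open>Lmat\<close> is a homomorphism of unital algebras and \<open>Rmat\<close> an antihomomorphism. Powers of a single
  element do not see the order of factors, so both representations carry \<open>q ^ n\<close> to the \<open>n\<close>-th
  power of a matrix (\<open>Lmat_power\<close>, \<open>Rmat_power\<close>), and the claim reduces to computing \<open>q ^ n\<close>.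

  A spacelike unit vector \<open>\<epsilon>\<close> satisfies \<open>\<epsilon>\<^sup>2 = 1\<close> as a split quaternion. Hence \<open>1\<close> and \<open>\<epsilon>\<close> span a
  copy of the hyperbolic numbers, in which the addition theorems for \<open>cosh\<close> and \<open>sinh\<close> say that
  \<open>cosh \<theta> + \<epsilon> sinh \<theta>\<close> is the exponential of \<open>\<theta> \<epsilon>\<close>; its \<open>n\<close>-th power is the exponential of
  \<open>n \<theta> \<epsilon>\<close> (\<open>hyperbolic_de_moivre\<close>). Linearity of the two representations then gives the stated
  matrices.
\<close>

lemma power_scaleR_algebra:
  fixes x :: "'a :: real_algebra_1"
  shows "(r *\<^sub>R x) ^ n = r ^ n *\<^sub>R x ^ n"
  by (induction n) (simp_all add: mult.commute)

text \<open>Because \<open>e * e = 1\<close>, the product of two elements of the span of \<open>1\<close> and \<open>e\<close> combines their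
  coefficients exactly as the addition theorems of \<open>cosh\<close> and \<open>sinh\<close> do, so the arguments add.\<close>

lemma hyperbolic_de_moivre:
  fixes e :: "'a :: real_algebra_1"
  assumes e: "e * e = 1"
  shows "(of_real (cosh t) + sinh t *\<^sub>R e) ^ n
    = of_real (cosh (n * t)) + sinh (n * t) *\<^sub>R e"
proof (induction n)
  case 0
  show ?case by simp
next
  case (Suc n)
  have "(of_real (cosh t) + sinh t *\<^sub>R e) ^ Suc n
      = (of_real (cosh t) + sinh t *\<^sub>R e) * (of_real (cosh (n * t)) + sinh (n * t) *\<^sub>R e)"
    by (simp add: Suc.IH)
  also have "\<dots> = of_real (cosh t * cosh (n * t) + sinh t * sinh (n * t))
      + (sinh t * cosh (n * t) + cosh t * sinh (n * t)) *\<^sub>R e"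
    by (simp add: algebra_simps of_real_def e)
  also have "\<dots> = of_real (cosh (t + n * t)) + sinh (t + n * t) *\<^sub>R e"
    by (simp only: cosh_add sinh_add)
  finally show ?case
    by (simp add: distrib_right)
qed

lemma pure_quat_square: "pure_quat u * pure_quat u = of_real (lorentz u u)"
  by (cases u) (simp add: split_quat_eq_iff pure_quat_def lorentz_def of_real_def
      split_i_def split_j_def split_k_def)

lemma Lmat_carrier [simp]: "Lmat q \<in> carrier_mat 4 4"
  unfolding Lmat_def mat_of_rows_list_def by (rule carrier_matI) simp_all

lemma Rmat_carrier [simp]: "Rmat q \<in> carrier_mat 4 4"
  unfolding Rmat_def mat_of_rows_list_def by (rule carrier_matI) simp_all

lemma sq_coords_carrier [simp]: "sq_coords p \<in> carrier_vec 4"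
  unfolding sq_coords_def by (rule carrier_vecI) simp

lemma mat_unit_vec_col:
  fixes A :: "'a :: semiring_1 mat"
  assumes "A \<in> carrier_mat m n" and "i < n"
  shows "A *\<^sub>v unit_vec n i = col A i"
  using assms by (intro eq_vecI) auto

text \<open>The coordinate map is onto \<open>\<real>\<^sup>4\<close>, so a matrix is determined by its action on coordinate
  vectors of split quaternions; matrix identities thus become identities of linear maps.\<close>

lemma eq_mat_on_coordsI:
  assumes A: "A \<in> carrier_mat 4 4" and B: "B \<in> carrier_mat 4 4"
    and eq: "\<And>p. A *\<^sub>v sq_coords p = B *\<^sub>v sq_coords p"
  shows "A = B"
proof (rule mat_col_eqI)
  fix i assume "i < dim_col B"
  then have i: "i < 4" using B by simp
  define p where "p = SQuat (of_bool (i = 0)) (of_bool (i = 1)) (of_bool (i = 2)) (of_bool (i = 3))"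
  have p: "sq_coords p = unit_vec 4 i"
    using i by (intro eq_vecI)
      (auto simp: sq_coords_def p_def unit_vec_def vec_of_list_index numeral_eq_Suc less_Suc_eq)
  show "col A i = col B i"
    using eq[of p] mat_unit_vec_col[OF A i] mat_unit_vec_col[OF B i] by (simp only: p)
qed (use A B in auto)

lemma Lmat_one: "Lmat 1 = 1\<^sub>m 4"
  by (rule eq_mat_on_coordsI) (simp_all add: Lmat_mult_coords)

lemma Rmat_one: "Rmat 1 = 1\<^sub>m 4"
  by (rule eq_mat_on_coordsI) (simp_all add: Rmat_mult_coords)

lemma Lmat_mult: "Lmat (p * q) = Lmat p * Lmat q"
  by (rule eq_mat_on_coordsI)
    (simp_all add: mult_carrier_mat[of _ 4 4] assoc_mult_mat_vec[of _ 4 4 _ 4]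
      Lmat_mult_coords mult.assoc)

text \<open>Right multiplication by \<open>p * q\<close> multiplies by \<open>p\<close> first, which reverses the factors.\<close>

lemma Rmat_mult: "Rmat (p * q) = Rmat q * Rmat p"
  by (rule eq_mat_on_coordsI)
    (simp_all add: mult_carrier_mat[of _ 4 4] assoc_mult_mat_vec[of _ 4 4 _ 4]
      Rmat_mult_coords mult.assoc)

lemma Lmat_power: "Lmat q ^\<^sub>m n = Lmat (q ^ n)"
proof (induction n)
  case 0
  show ?case using carrier_matD(1)[OF Lmat_carrier[of q]] by (simp add: Lmat_one)
next
  case (Suc n)
  then show ?case by (simp only: pow_mat.simps Lmat_mult power_Suc2)
qed

lemma Rmat_power: "Rmat q ^\<^sub>m n = Rmat (q ^ n)"
proof (induction n)
  case 0
  show ?case using carrier_matD(1)[OF Rmat_carrier[of q]] by (simp add: Rmat_one)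
next
  case (Suc n)
  then show ?case by (simp only: pow_mat.simps Rmat_mult power_Suc)
qed

lemma Lmat_scalar_plus_scaled:
  "Lmat (c *\<^sub>R (of_real a + b *\<^sub>R p)) = c \<cdot>\<^sub>m (a \<cdot>\<^sub>m 1\<^sub>m 4 + b \<cdot>\<^sub>m Lmat p)"
  by (rule eq_matI)
    (auto simp: Lmat_def mat_of_rows_list_def of_real_def numeral_eq_Suc less_Suc_eq)

lemma Rmat_scalar_plus_scaled:
  "Rmat (c *\<^sub>R (of_real a + b *\<^sub>R p)) = c \<cdot>\<^sub>m (a \<cdot>\<^sub>m 1\<^sub>m 4 + b \<cdot>\<^sub>m Rmat p)"
  by (rule eq_matI)
    (auto simp: Rmat_def mat_of_rows_list_def of_real_def numeral_eq_Suc less_Suc_eq)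

lemma Lmat_scalar_plus_pure:
  "a \<cdot>\<^sub>m 1\<^sub>m 4 + b \<cdot>\<^sub>m Lmat (pure_quat (u1, u2, u3)) = mat_of_rows_list 4
    [[a, - u1 * b, u2 * b, u3 * b],
     [u1 * b, a, u3 * b, - u2 * b],
     [u2 * b, u3 * b, a, - u1 * b],
     [u3 * b, - u2 * b, u1 * b, a]]"
  by (rule eq_matI)
    (auto simp: Lmat_def mat_of_rows_list_def pure_quat_def split_i_def split_j_def split_k_def
      numeral_eq_Suc less_Suc_eq)

lemma Rmat_scalar_plus_pure:
  "a \<cdot>\<^sub>m 1\<^sub>m 4 + b \<cdot>\<^sub>m Rmat (pure_quat (u1, u2, u3)) = mat_of_rows_list 4
    [[a, - u1 * b, u2 * b, u3 * b],
     [u1 * b, a, - u3 * b, u2 * b],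
     [u2 * b, - u3 * b, a, u1 * b],
     [u3 * b, u2 * b, - u1 * b, a]]"
  by (rule eq_matI)
    (auto simp: Rmat_def mat_of_rows_list_def pure_quat_def split_i_def split_j_def split_k_def
      numeral_eq_Suc less_Suc_eq)

theorem theorem3:
  fixes q :: split_quat and \<theta> u1 u2 u3 :: real and \<epsilon> :: mink3 and n :: nat
  assumes "timelike q"
    and "spacelike_vec (vec_part q)"
    and "\<epsilon> = (u1, u2, u3)"
    and "spacelike_unit_vec \<epsilon>"
    and "q = sq_N q *\<^sub>R (of_real (cosh \<theta>) + sinh \<theta> *\<^sub>R pure_quat \<epsilon>)"
    and "n > 0"
  shows
    "(Lmat q ^\<^sub>m n = (sq_N q) ^ n \<cdot>\<^sub>m mat_of_rows_list 4
        [[cosh (n * \<theta>), - u1 * sinh (n * \<theta>), u2 * sinh (n * \<theta>), u3 * sinh (n * \<theta>)],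
         [u1 * sinh (n * \<theta>), cosh (n * \<theta>), u3 * sinh (n * \<theta>), - u2 * sinh (n * \<theta>)],
         [u2 * sinh (n * \<theta>), u3 * sinh (n * \<theta>), cosh (n * \<theta>), - u1 * sinh (n * \<theta>)],
         [u3 * sinh (n * \<theta>), - u2 * sinh (n * \<theta>), u1 * sinh (n * \<theta>), cosh (n * \<theta>)]]
      \<and> Lmat q ^\<^sub>m n = (sq_N q) ^ n \<cdot>\<^sub>m
          (cosh (n * \<theta>) \<cdot>\<^sub>m 1\<^sub>m 4 + sinh (n * \<theta>) \<cdot>\<^sub>m Lmat (pure_quat \<epsilon>)))
   \<and> (Rmat q ^\<^sub>m n = (sq_N q) ^ n \<cdot>\<^sub>m mat_of_rows_list 4
        [[cosh (n * \<theta>), - u1 * sinh (n * \<theta>), u2 * sinh (n * \<theta>), u3 * sinh (n * \<theta>)],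
         [u1 * sinh (n * \<theta>), cosh (n * \<theta>), - u3 * sinh (n * \<theta>), u2 * sinh (n * \<theta>)],
         [u2 * sinh (n * \<theta>), - u3 * sinh (n * \<theta>), cosh (n * \<theta>), u1 * sinh (n * \<theta>)],
         [u3 * sinh (n * \<theta>), u2 * sinh (n * \<theta>), - u1 * sinh (n * \<theta>), cosh (n * \<theta>)]]
      \<and> Rmat q ^\<^sub>m n = (sq_N q) ^ n \<cdot>\<^sub>m
          (cosh (n * \<theta>) \<cdot>\<^sub>m 1\<^sub>m 4 + sinh (n * \<theta>) \<cdot>\<^sub>m Rmat (pure_quat \<epsilon>)))"
proof -
  have "pure_quat \<epsilon> * pure_quat \<epsilon> = 1"
    using assms(4) by (simp add: pure_quat_square spacelike_unit_vec_def)
  then have unit_power: "(of_real (cosh \<theta>) + sinh \<theta> *\<^sub>R pure_quat \<epsilon>) ^ n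
      = of_real (cosh (n * \<theta>)) + sinh (n * \<theta>) *\<^sub>R pure_quat \<epsilon>"
    by (rule hyperbolic_de_moivre)
  have "q ^ n = (sq_N q *\<^sub>R (of_real (cosh \<theta>) + sinh \<theta> *\<^sub>R pure_quat \<epsilon>)) ^ n"
    using assms(5) by (rule arg_cong)
  also have "\<dots> = sq_N q ^ n *\<^sub>R (of_real (cosh (n * \<theta>)) + sinh (n * \<theta>) *\<^sub>R pure_quat \<epsilon>)"
    by (simp only: power_scaleR_algebra unit_power)
  finally have q_power: "q ^ n
      = sq_N q ^ n *\<^sub>R (of_real (cosh (n * \<theta>)) + sinh (n * \<theta>) *\<^sub>R pure_quat \<epsilon>)" .
  have L: "Lmat q ^\<^sub>m n = sq_N q ^ n \<cdot>\<^sub>m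
      (cosh (n * \<theta>) \<cdot>\<^sub>m 1\<^sub>m 4 + sinh (n * \<theta>) \<cdot>\<^sub>m Lmat (pure_quat \<epsilon>))"
    by (simp only: Lmat_power q_power Lmat_scalar_plus_scaled)
  have R: "Rmat q ^\<^sub>m n = sq_N q ^ n \<cdot>\<^sub>m
      (cosh (n * \<theta>) \<cdot>\<^sub>m 1\<^sub>m 4 + sinh (n * \<theta>) \<cdot>\<^sub>m Rmat (pure_quat \<epsilon>))"
    by (simp only: Rmat_power q_power Rmat_scalar_plus_scaled)
  show ?thesis
    unfolding L R unfolding assms(3) Lmat_scalar_plus_pure Rmat_scalar_plus_pure by simp
qed

end
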